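(* Let $D$ be a non-square positive integer, let $(\alpha,\beta)$ be the fundamental solution of $x^2-Dy^2=1$, let $f=u+v$ and let $g=f^{-1}$. Then for any real number $x\ge 1$, $$\lfloor g(x)\rfloor=\left\lfloor\frac{\log(\lfloor x\rfloor)+C}{\log(\alpha+\beta\sqrt{D})}\right\rfloor,$$ where $C=\log\left(\frac{2\sqrt{D}}{1+\sqrt{D}}\right)$ is a positive real constant. More precisely, there exists a bounded function $\mu:[1,\infty)\to[0,1)$ which vanishes precisely at the points $f(0),f(1),f(2),\dots$, and satisfies $$g(x)=\left\lfloor\frac{\log(\lfloor x\rfloor)+C}{\log(\alpha+\beta\sqrt{D})}\right\rfloor+\mu(x)$$ for all $x\ge 1$.
   Context: Let $D$ be a non-square positive integer. The fundamental solution $(\alpha,\beta)$ of the Pell equation $x^2-Dy^2=1$ is the solution in positive integers with the smallest value of $x+y\sqrt{D}$ among all positive integer solutions. Define $u:[0,\infty)\to[1,\infty)$ and $v:[0,\infty)\to[0,\infty)$ by $$u(x)=\tfrac12\left\{(\alpha+\beta\sqrt{D})^x+(\alpha-\beta\sqrt{D})^x\right\},\qquad v(x)=\tfrac{1}{2\sqrt{D}}\left\{(\alpha+\beta\sqrt{D})^x-(\alpha-\beta\sqrt{D})^x\right\}.$$ The function $f:[0,\infty)\to[1,\infty)$, $f=u+v$, is a strictly increasing bijection, and $g:=f^{-1}:[1,\infty)\to[0,\infty)$ denotes its inverse. $\lfloor\cdot\rfloor$ is the floor function. *)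

theory Defs
  imports "HOL-Analysis.Analysis" "HOL-Computational_Algebra.Nth_Powers"
begin

definition pell_solution :: "int \<Rightarrow> int \<Rightarrow> int \<Rightarrow> bool" where
  "pell_solution D x y \<longleftrightarrow> x\<^sup>2 - D * y\<^sup>2 = 1"

definition fundamental_solution :: "int \<Rightarrow> int \<Rightarrow> int \<Rightarrow> bool" where
  "fundamental_solution D \<alpha> \<beta> \<longleftrightarrow>
     \<alpha> > 0 \<and> \<beta> > 0 \<and> pell_solution D \<alpha> \<beta> \<and>
     (\<forall>x y. x > 0 \<longrightarrow> y > 0 \<longrightarrow> pell_solution D x y \<longrightarrow>
        \<alpha> + \<beta> * sqrt D \<le> x + y * sqrt D)"

definition pell_u :: "int \<Rightarrow> int \<Rightarrow> int \<Rightarrow> real \<Rightarrow> real" where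
  "pell_u D \<alpha> \<beta> x =
     1 / 2 * ((\<alpha> + \<beta> * sqrt D) powr x + (\<alpha> - \<beta> * sqrt D) powr x)"

definition pell_v :: "int \<Rightarrow> int \<Rightarrow> int \<Rightarrow> real \<Rightarrow> real" where
  "pell_v D \<alpha> \<beta> x =
     1 / (2 * sqrt D) * ((\<alpha> + \<beta> * sqrt D) powr x - (\<alpha> - \<beta> * sqrt D) powr x)"

definition pell_f :: "int \<Rightarrow> int \<Rightarrow> int \<Rightarrow> real \<Rightarrow> real" where
  "pell_f D \<alpha> \<beta> x = pell_u D \<alpha> \<beta> x + pell_v D \<alpha> \<beta> x"

text \<open>The inverse of \<open>pell_f D \<alpha> \<beta> : [0,\<infinity>) \<rightarrow> [1,\<infinity>)\<close>. It is meaningful only for arguments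
  \<open>\<ge> 1\<close>; see \<open>bij_betw_pell_f\<close> below.\<close>

definition pell_g :: "int \<Rightarrow> int \<Rightarrow> int \<Rightarrow> real \<Rightarrow> real" where
  "pell_g D \<alpha> \<beta> = the_inv_into {0..} (pell_f D \<alpha> \<beta>)"

lemma
  assumes D: "D > 0" "\<not> is_square (D :: int)" and fund: "fundamental_solution D \<alpha> \<beta>"
  shows strict_mono_on_pell_f: "strict_mono_on {0..} (pell_f D \<alpha> \<beta>)"
    and bij_betw_pell_f: "bij_betw (pell_f D \<alpha> \<beta>) {0..} {1..}"
proof -
  define e where "e = \<alpha> + \<beta> * sqrt D"
  define A where "A = 1 / 2 * (1 + 1 / sqrt D)"
  define B where "B = 1 / 2 * (1 - 1 / sqrt D)"
  have "D \<noteq> 1" using D(2) by auto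
  with D(1) have D2: "D \<ge> 2" by linarith
  hence s: "sqrt D > 1" by simp
  have ab: "\<alpha> \<ge> 1" "\<beta> \<ge> 1" "\<alpha>\<^sup>2 - D * \<beta>\<^sup>2 = 1"
    using fund by (auto simp: fundamental_solution_def pell_solution_def)
  have "real_of_int \<beta> * sqrt D > 0" using ab s by simp
  hence e1: "e > 1" using ab by (simp add: e_def)
  have "real_of_int (\<alpha>\<^sup>2 - D * \<beta>\<^sup>2) = 1" using ab(3) by simp
  hence "e * (\<alpha> - \<beta> * sqrt D) = 1"
    using D(1) by (simp add: e_def algebra_simps power2_eq_square)
  hence conj: "\<alpha> - \<beta> * sqrt D = inverse e" using e1 by (simp add: field_simps)
  have AB: "A > B" "B > 0" "A + B = 1" using s by (auto simp: A_def B_def field_simps)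
  have f: "pell_f D \<alpha> \<beta> x = A * e powr x + B * inverse (e powr x)" for x
  proof -
    have "inverse e powr x = inverse (e powr x)"
      using e1 by (simp add: powr_def ln_inverse exp_minus)
    thus ?thesis
      unfolding pell_f_def pell_u_def pell_v_def conj e_def [symmetric] A_def B_def
      by (simp add: algebra_simps add_divide_distrib diff_divide_distrib)
  qed
  have less: "pell_f D \<alpha> \<beta> x < pell_f D \<alpha> \<beta> y" if "0 \<le> x" "x < y" for x y
  proof -
    define p q where "p = e powr x" and "q = e powr y"
    have p: "p \<ge> 1" "q > p" using that e1 by (auto simp: p_def q_def ge_one_powr_ge_zero)
    have pq: "p * q > 1" using p by (smt (verit) mult_less_cancel_left1)
    hence "B / (p * q) \<le> B" using AB by (simp add: field_simps)
    hence "(q - p) * (A - B / (p * q)) > 0" using AB p by simp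
    also have "(q - p) * (A - B / (p * q)) = (A * q + B * inverse q) - (A * p + B * inverse p)"
      using p by (simp add: field_simps)
    finally show ?thesis by (simp add: f p_def q_def)
  qed
  thus mono: "strict_mono_on {0..} (pell_f D \<alpha> \<beta>)"
    by (auto simp: strict_mono_on_def)
  have f0: "pell_f D \<alpha> \<beta> 0 = 1" using AB e1 by (simp add: f)
  have cont: "continuous_on S (pell_f D \<alpha> \<beta>)" for S
    unfolding f [abs_def] using e1 by (intro continuous_intros) auto
  have "y \<in> pell_f D \<alpha> \<beta> ` {0..}" if y: "y \<ge> 1" for y
  proof -
    define z where "z = log e (y / A)"
    have "A \<le> 1" using AB by linarith
    hence z: "z \<ge> 0" using y AB e1 by (simp add: z_def zero_le_log_cancel_iff field_simps)
    have "e powr z = y / A" using y AB e1 by (simp add: z_def)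
    hence "pell_f D \<alpha> \<beta> z = y + B * inverse (y / A)" using AB by (simp add: f)
    moreover have "B * inverse (y / A) \<ge> 0" using AB y by simp
    ultimately have "y \<le> pell_f D \<alpha> \<beta> z" by linarith
    then obtain x where "0 \<le> x" "x \<le> z" "pell_f D \<alpha> \<beta> x = y"
      using IVT' [of "pell_f D \<alpha> \<beta>" 0 y z] f0 y z cont by auto
    thus ?thesis by auto
  qed
  moreover have "pell_f D \<alpha> \<beta> x \<ge> 1" if "x \<ge> 0" for x
    using less [of 0 x] f0 that by (cases "x = 0") auto
  ultimately have "pell_f D \<alpha> \<beta> ` {0..} = {1..}" by auto
  thus "bij_betw (pell_f D \<alpha> \<beta>) {0..} {1..}"
    using strict_mono_on_imp_inj_on [OF mono] by (simp add: bij_betw_def)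
qed

end

theory Submission
  imports Defs
begin

text \<open>With $e = \alpha + \beta\sqrt D$ one has $f(x) = A e^x + B e^{-x}$, where
  $A = (1 + 1/\sqrt D)/2$ satisfies $\log A = -C$, and $B = 1 - A$ lies in $(0,1)$. The values
  $f(n)$ at natural numbers are integers, so $f(n) \le x < f(n+1)$ amounts to
  $f(n) \le \lfloor x\rfloor \le f(n+1) - 1$. Since $B e^{-n} > 0$ and $B e^{-(n+1)} < 1$, this gives
  $A e^n \le \lfloor x\rfloor < A e^{n+1}$; now take logarithms.\<close>

text \<open>Replacing \<open>sqrt D\<close> by \<open>- sqrt D\<close> is multiplicative on numbers
  \<open>a + b * sqrt D\<close>, so one pair of integers serves both powers. Because the pair is
  shared, half the sum of the powers is \<open>a\<close> and half the difference is
  \<open>b * sqrt D\<close>.\<close>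

lemma power_add_sqrt_conjugates:
  fixes D \<alpha> \<beta> :: int
  assumes "D \<ge> 0"
  shows "\<exists>(a::int) (b::int). (\<alpha> + \<beta> * sqrt D) ^ n = a + b * sqrt D \<and> (\<alpha> - \<beta> * sqrt D) ^ n = a - b * sqrt D"
proof (induction n)
  case 0
  show ?case by (intro exI [of _ 1] exI [of _ 0]) simp
next
  case (Suc n)
  then obtain a b :: int where ab:
    "(\<alpha> + \<beta> * sqrt D) ^ n = a + b * sqrt D" "(\<alpha> - \<beta> * sqrt D) ^ n = a - b * sqrt D"
    by blast
  \<comment> \<open>The trailing factor \<open>z\<close> fits the right-nested products left by
    \<open>algebra_simps\<close>. The witnesses below are the coefficients of the product of
    \<open>\<alpha> + \<beta> * sqrt D\<close> and \<open>a + b * sqrt D\<close>.\<close>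
  have "sqrt D * (sqrt D * z) = D * z" for z
    using assms by (simp flip: mult.assoc)
  then show ?case
    by (intro exI [of _ "\<alpha> * a + D * \<beta> * b"] exI [of _ "\<alpha> * b + \<beta> * a"]) (simp add: ab algebra_simps)
qed

text \<open>The Pell equation says that the two conjugates have product 1. The second is therefore
  positive too, so that \<open>powr\<close> has its usual meaning for both bases.\<close>

lemma fundamental_solution_conjugate:
  assumes "D > 0" and "fundamental_solution D \<alpha> \<beta>"
  shows "\<alpha> + \<beta> * sqrt D > 1" and "\<alpha> - \<beta> * sqrt D = inverse (\<alpha> + \<beta> * sqrt D)"
proof -
  have ab: "\<alpha> \<ge> 1" "\<beta> \<ge> 1" "\<alpha>\<^sup>2 - D * \<beta>\<^sup>2 = 1"
    using assms by (auto simp: fundamental_solution_def pell_solution_def)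
  have "real_of_int \<beta> * sqrt D > 0" using ab assms by simp
  with ab show gt: "\<alpha> + \<beta> * sqrt D > 1" by linarith
  have "real_of_int (\<alpha>\<^sup>2 - D * \<beta>\<^sup>2) = 1" using ab(3) by simp
  hence "(\<alpha> + \<beta> * sqrt D) * (\<alpha> - \<beta> * sqrt D) = 1"
    using assms(1) by (simp add: algebra_simps power2_eq_square)
  thus "\<alpha> - \<beta> * sqrt D = inverse (\<alpha> + \<beta> * sqrt D)"
    by (rule inverse_unique [symmetric])
qed

lemma pell_f_of_nat:
  assumes "D > 0" and "fundamental_solution D \<alpha> \<beta>"
  shows "pell_f D \<alpha> \<beta> (real n) =
    (1 + 1 / sqrt D) / 2 * (\<alpha> + \<beta> * sqrt D) ^ n + (1 - 1 / sqrt D) / 2 / (\<alpha> + \<beta> * sqrt D) ^ n"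
proof -
  define e where "e = \<alpha> + \<beta> * sqrt D"
  have e: "e > 0" and conj: "\<alpha> - \<beta> * sqrt D = inverse e"
    using fundamental_solution_conjugate [OF assms] by (simp_all add: e_def)
  show ?thesis
    unfolding pell_f_def pell_u_def pell_v_def conj e_def [symmetric]
    using e \<open>D > 0\<close> by (simp add: powr_realpow power_inverse field_simps)
qed

text \<open>For the integers \<open>a\<close> and \<open>b\<close> of the \<open>n\<close>-th
  powers, u(n) is \<open>a\<close> and v(n) is \<open>b\<close>.\<close>

lemma pell_f_of_nat_in_Ints:
  assumes "D > 0" and "fundamental_solution D \<alpha> \<beta>"
  shows "pell_f D \<alpha> \<beta> (real n) \<in> \<int>"
proof -
  have pos: "\<alpha> + \<beta> * sqrt D > 0" "\<alpha> - \<beta> * sqrt D > 0"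
    using fundamental_solution_conjugate [OF assms] by simp_all
  obtain a b :: int where
    "(\<alpha> + \<beta> * sqrt D) ^ n = a + b * sqrt D" "(\<alpha> - \<beta> * sqrt D) ^ n = a - b * sqrt D"
    using power_add_sqrt_conjugates \<open>D > 0\<close> by (meson less_imp_le)
  hence "pell_f D \<alpha> \<beta> (real n) = of_int (a + b)"
    using pos \<open>D > 0\<close>
    by (simp add: pell_f_def pell_u_def pell_v_def powr_realpow field_simps)
  thus ?thesis by simp
qed

lemma
  assumes "D > 0" and "\<not> is_square D" and "fundamental_solution D \<alpha> \<beta>" and "x \<ge> 1"
  shows pell_g_nonneg: "pell_g D \<alpha> \<beta> x \<ge> 0"
    and pell_f_pell_g: "pell_f D \<alpha> \<beta> (pell_g D \<alpha> \<beta> x) = x"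
proof -
  have bij: "inj_on (pell_f D \<alpha> \<beta>) {0..}" "x \<in> pell_f D \<alpha> \<beta> ` {0..}"
    using bij_betw_pell_f [OF assms(1-3)] \<open>x \<ge> 1\<close> by (auto simp: bij_betw_def)
  show "pell_f D \<alpha> \<beta> (pell_g D \<alpha> \<beta> x) = x"
    unfolding pell_g_def using bij by (rule f_the_inv_into_f)
  show "pell_g D \<alpha> \<beta> x \<ge> 0"
    unfolding pell_g_def using the_inv_into_into [OF bij order_refl] by simp
qed

lemma pell_g_pell_f:
  assumes "D > 0" and "\<not> is_square D" and "fundamental_solution D \<alpha> \<beta>" and "x \<ge> 0"
  shows "pell_g D \<alpha> \<beta> (pell_f D \<alpha> \<beta> x) = x"
  unfolding pell_g_def
  using bij_betw_pell_f [OF assms(1-3)] \<open>x \<ge> 0\<close> by (simp add: bij_betw_def the_inv_into_f_f)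

lemma one_less_sqrt_nonsquare:
  fixes D :: int
  assumes "D > 0" and "\<not> is_square D"
  shows "sqrt D > 1"
proof -
  have "D \<noteq> 1" using assms(2) by auto
  with assms(1) show ?thesis by simp
qed

lemma floor_pell_g:
  assumes "D > 0" and "\<not> is_square D" and "fundamental_solution D \<alpha> \<beta>" and "x \<ge> 1"
  shows "\<lfloor>pell_g D \<alpha> \<beta> x\<rfloor> =
    \<lfloor>(ln (of_int \<lfloor>x\<rfloor>) + ln (2 * sqrt D / (1 + sqrt D))) / ln (\<alpha> + \<beta> * sqrt D)\<rfloor>"
proof -
  define e where "e = \<alpha> + \<beta> * sqrt D"
  define r where "r = 1 / sqrt D"
  define A B where "A = (1 + r) / 2" and "B = (1 - r) / 2"
  define N where "N = real_of_int \<lfloor>x\<rfloor>"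
  \<comment> \<open>The goal becomes that the logarithmic quotient lies between \<open>n\<close> and
    \<open>n + 1\<close>.\<close>
  define n where "n = nat \<lfloor>pell_g D \<alpha> \<beta> x\<rfloor>"
  note s = one_less_sqrt_nonsquare [OF assms(1,2)]
  note mono = strict_mono_on_pell_f [OF assms(1-3)]
  have e: "e > 1" unfolding e_def by (rule fundamental_solution_conjugate [OF assms(1,3)])
  have "0 < r" "r < 1" using s by (simp_all add: r_def)
  hence AB: "A > 0" "B > 0" "B < 1" by (simp_all add: A_def B_def)
  have f: "pell_f D \<alpha> \<beta> (real m) = A * e ^ m + B / e ^ m" for m
    unfolding A_def B_def r_def e_def by (rule pell_f_of_nat [OF assms(1,3)])
  have N: "N \<ge> 1" using \<open>x \<ge> 1\<close> by (simp add: N_def)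
  have g0: "pell_g D \<alpha> \<beta> x \<ge> 0" by (rule pell_g_nonneg [OF assms])
  have n: "real n \<le> pell_g D \<alpha> \<beta> x" "pell_g D \<alpha> \<beta> x < real (Suc n)"
    using g0 by (auto simp: n_def) linarith
  have "pell_f D \<alpha> \<beta> (real n) \<le> x"
    using strict_mono_on_leD [OF mono _ _ n(1)] g0 by (simp add: pell_f_pell_g [OF assms])
  \<comment> \<open>An integer below \<open>x\<close> is also below the floor of
    \<open>x\<close>.\<close>
  hence lower: "pell_f D \<alpha> \<beta> (real n) \<le> N"
    using pell_f_of_nat_in_Ints [OF assms(1,3), of n] by (auto simp: N_def le_floor_iff elim!: Ints_cases)
  obtain k where k: "pell_f D \<alpha> \<beta> (real (Suc n)) = real_of_int k"
    using pell_f_of_nat_in_Ints [OF assms(1,3)] Ints_cases by blast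
  have "x < pell_f D \<alpha> \<beta> (real (Suc n))"
    using strict_mono_onD [OF mono _ _ n(2)] g0 by (simp add: pell_f_pell_g [OF assms])
  \<comment> \<open>Strictness between integers gains a full 1, which later absorbs the term
    \<open>B / e ^ Suc n\<close>.\<close>
  hence "\<lfloor>x\<rfloor> + 1 \<le> k" unfolding k by linarith
  hence upper: "N + 1 \<le> pell_f D \<alpha> \<beta> (real (Suc n))" unfolding k N_def by linarith
  have "B / e ^ n > 0" using AB e by simp
  with lower have "A * e ^ n \<le> N" unfolding f by linarith
  hence "ln (A * e ^ n) \<le> ln N" using AB e N by (subst ln_le_cancel_iff) auto
  hence l: "real n * ln e \<le> ln N - ln A"
    using AB e by (simp add: ln_mult ln_realpow)
  have "B < e ^ Suc n"
    using AB(3) one_le_power [of e "Suc n"] e by linarith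
  hence "B / e ^ Suc n < 1"
    using e by (simp add: divide_less_eq del: power_Suc)
  with upper have "N < A * e ^ Suc n" unfolding f by linarith
  hence "ln N < ln (A * e ^ Suc n)" using N by (intro ln_less_cancel_iff [THEN iffD2]) auto
  also have "ln (A * e ^ Suc n) = ln A + real (Suc n) * ln e"
    using AB e by (simp add: ln_mult ln_realpow del: power_Suc)
  finally have u: "ln N - ln A < (real n + 1) * ln e" by (simp add: algebra_simps)
  \<comment> \<open>This is where \<open>C\<close> comes from: it is minus the logarithm of the
    leading coefficient \<open>A\<close>.\<close>
  have "2 * sqrt D / (1 + sqrt D) = inverse A"
    using s by (simp add: A_def r_def field_simps)
  hence C: "ln (2 * sqrt D / (1 + sqrt D)) = - ln A"
    using AB by (simp add: ln_inverse)
  have "\<lfloor>(ln N + ln (2 * sqrt D / (1 + sqrt D))) / ln e\<rfloor> = int n"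
    unfolding C using l u e by (intro floor_unique) (simp_all add: field_simps)
  thus ?thesis using g0 by (simp add: N_def e_def n_def)
qed

theorem theorem2p3:
  fixes D \<alpha> \<beta> :: int and f g :: "real \<Rightarrow> real" and C :: real
  assumes "D > 0" and "\<not> is_square D"
    and "fundamental_solution D \<alpha> \<beta>"
  defines "f \<equiv> pell_f D \<alpha> \<beta>"
    and "g \<equiv> pell_g D \<alpha> \<beta>"
    and "C \<equiv> ln (2 * sqrt D / (1 + sqrt D))"
  shows "C > 0 \<and>
    (\<forall>x\<ge>1. \<lfloor>g x\<rfloor> = \<lfloor>(ln (of_int \<lfloor>x\<rfloor>) + C) / ln (\<alpha> + \<beta> * sqrt D)\<rfloor>) \<and>
    (\<exists>\<mu> :: real \<Rightarrow> real.
       \<mu> \<in> {1..} \<rightarrow> {0..<1} \<and> bounded (\<mu> ` {1..}) \<and>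
       (\<forall>x\<ge>1. \<mu> x = 0 \<longleftrightarrow> (\<exists>n :: nat. x = f (real n))) \<and>
       (\<forall>x\<ge>1. g x = of_int \<lfloor>(ln (of_int \<lfloor>x\<rfloor>) + C) / ln (\<alpha> + \<beta> * sqrt D)\<rfloor> + \<mu> x))"
proof -
  note D = assms(1-3)
  have "C > 0"
    \<comment> \<open>Positivity amounts to \<open>1 + sqrt D < 2 * sqrt D\<close>. The deleted simp
      rule would turn the fact \<open>sqrt D > 1\<close> into one about \<open>D\<close>.\<close>
    unfolding C_def using one_less_sqrt_nonsquare [OF D(1,2)]
    by (intro ln_gt_zero) (simp add: less_divide_eq del: real_sqrt_gt_1_iff)
  moreover have floor: "\<lfloor>g x\<rfloor> = \<lfloor>(ln (of_int \<lfloor>x\<rfloor>) + C) / ln (\<alpha> + \<beta> * sqrt D)\<rfloor>" if "x \<ge> 1" for x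
    unfolding g_def C_def by (rule floor_pell_g [OF D that])
  \<comment> \<open>The floor formula forces \<mu> to be the fractional part of \<open>g\<close> on
    \<open>{1..}\<close>; it vanishes exactly where \<open>g x\<close> is an integer.\<close>
  moreover have "(\<lambda>x. frac (g x)) \<in> {1..} \<rightarrow> {0..<1}"
    by (simp add: frac_lt_1)
  moreover have "bounded ((\<lambda>x. frac (g x)) ` {1..})"
    by (rule bounded_subset [of "{0..1}"]) (auto simp: frac_lt_1 less_imp_le)
  moreover have "frac (g x) = 0 \<longleftrightarrow> (\<exists>n :: nat. x = f (real n))" if x: "x \<ge> 1" for x
  proof
    assume "frac (g x) = 0"
    then obtain k where k: "g x = of_int k"
      by (auto simp: frac_eq_0_iff elim: Ints_cases)
    \<comment> \<open>Nonnegativity of \<open>g x\<close> makes the integer \<open>k\<close> a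
      natural number; applying \<open>f\<close> then recovers \<open>x\<close>.\<close>
    with pell_g_nonneg [OF D x] have "g x = real (nat k)" by (simp add: g_def)
    with pell_f_pell_g [OF D x] show "\<exists>n :: nat. x = f (real n)"
      by (metis f_def g_def)
  next
    assume "\<exists>n :: nat. x = f (real n)"
    thus "frac (g x) = 0" using pell_g_pell_f [OF D] by (auto simp: f_def g_def)
  qed
  moreover have "g x = of_int \<lfloor>(ln (of_int \<lfloor>x\<rfloor>) + C) / ln (\<alpha> + \<beta> * sqrt D)\<rfloor> + frac (g x)"
    if "x \<ge> 1" for x
    by (simp add: floor [OF that, symmetric] frac_def)
  ultimately show ?thesis
    by (intro conjI exI [of _ "\<lambda>x. frac (g x)"]) blast+
qed

end
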